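(* If $G$ is a simple mixed graph, then $|\lambda|\le\max\{\Delta_1(G),\Delta_2(G)\}$ for each eigenvalue $\lambda$ of $\mathcal{I}(G)$, where $\Delta_1(G)=\max\{d(u)+d^+(u)\mid u\in V_G\}$ and $\Delta_2(G)=\max\{d(u)+d^-(u)\mid u\in V_G\}$.
   Context: A mixed graph $G$ has a finite nonempty vertex set $V_G=\{v_1,\dots,v_n\}$, a finite set $E_G$ of (undirected) edges, each joining an unordered pair of vertices $\{u,v\}$ (a loop if $u=v$), and a finite set $\vec E_G$ of arcs, each going from $u$ to $v$ for an ordered pair $(u,v)$ of vertices (a directed loop if $u=v$); multiple edges, loops, arcs and directed loops are allowed. $G$ is simple if it has no loops, no directed loops, at most one edge joining any two vertices, and at most one arc from $u$ to $v$ for each ordered pair $(u,v)$ (an edge and arcs in both directions may coexist on the same pair of vertices). The integrated adjacency matrix $\mathcal{I}(G)$ is the real symmetric $2n\times 2n$ matrix $\begin{bmatrix}A&D\\ D^T&A\end{bmatrix}$, where $A_{ij}$ ($i\neq j$) is the number of edges joining $v_i$ and $v_j$, $A_{ii}$ is twice the number of loops at $v_i$, and $D_{ij}$ is the number of arcs from $v_i$ to $v_j$. Degrees: $d(u)$ is the number of edges incident with $u$ (loops counted twice), $d^+(u)$ the number of arcs starting at $u$, $d^-(u)$ the number of arcs ending at $u$. *)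

theory Defs
  imports
    "HOL-Library.Uprod"
    "Graph_Theory.Digraph"
    "Jordan_Normal_Form.Char_Poly"
begin

text \<open>
  A mixed graph is a digraph with, in addition, a set of undirected edges. Both arcs and edges
  are named objects, so that parallel ones are distinct; an edge is mapped to the unordered pair of
  its end vertices, and it is a loop at \<open>u\<close> iff this pair is \<open>Upair u u\<close>.
\<close>

record ('a, 'b, 'e) pre_mixed_graph = "('a, 'b) pre_digraph" +
  edges :: "'e set"
  ends :: "'e \<Rightarrow> 'a uprod"

definition directed_part :: "('a, 'b, 'e) pre_mixed_graph \<Rightarrow> ('a, 'b) pre_digraph" where
  "directed_part G = \<lparr>verts = verts G, arcs = arcs G, tail = tail G, head = head G\<rparr>"

locale mixed_graph = fin_digraph "directed_part G"
  for G :: "('a, 'b, 'e) pre_mixed_graph" +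
  assumes verts_nonempty: "verts G \<noteq> {}"
    and finite_edges: "finite (edges G)"
    and ends_in_verts: "e \<in> edges G \<Longrightarrow> set_uprod (ends G e) \<subseteq> verts G"

locale simple_mixed_graph =
  mixed_graph G + loopfree_digraph "directed_part G" + nomulti_digraph "directed_part G"
  for G :: "('a, 'b, 'e) pre_mixed_graph" +
  assumes no_edge_loops: "e \<in> edges G \<Longrightarrow> ends G e \<noteq> Upair u u"
    and no_multi_edges: "\<lbrakk>e1 \<in> edges G; e2 \<in> edges G; ends G e1 = ends G e2\<rbrakk> \<Longrightarrow> e1 = e2"

definition edges_joining :: "('a, 'b, 'e) pre_mixed_graph \<Rightarrow> 'a \<Rightarrow> 'a \<Rightarrow> 'e set" where
  "edges_joining G u v = {e \<in> edges G. ends G e = Upair u v}"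

definition arcs_from_to :: "('a, 'b, 'e) pre_mixed_graph \<Rightarrow> 'a \<Rightarrow> 'a \<Rightarrow> 'b set" where
  "arcs_from_to G u v = {a \<in> arcs G. tail G a = u \<and> head G a = v}"

text \<open>In the degree, the second summand makes every loop count twice.\<close>

definition deg :: "('a, 'b, 'e) pre_mixed_graph \<Rightarrow> 'a \<Rightarrow> nat" where
  "deg G u = card {e \<in> edges G. u \<in> set_uprod (ends G e)} + card (edges_joining G u u)"

definition out_deg :: "('a, 'b, 'e) pre_mixed_graph \<Rightarrow> 'a \<Rightarrow> nat" where
  "out_deg G u = out_degree (directed_part G) u"

definition in_deg :: "('a, 'b, 'e) pre_mixed_graph \<Rightarrow> 'a \<Rightarrow> nat" where
  "in_deg G u = in_degree (directed_part G) u"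

definition Delta1 :: "('a, 'b, 'e) pre_mixed_graph \<Rightarrow> nat" where
  "Delta1 G = Max {deg G u + out_deg G u | u. u \<in> verts G}"

definition Delta2 :: "('a, 'b, 'e) pre_mixed_graph \<Rightarrow> nat" where
  "Delta2 G = Max {deg G u + in_deg G u | u. u \<in> verts G}"

text \<open>
  The matrices depend on an enumeration of the vertices, given here as a list \<open>vs\<close>, which is
  meant to satisfy \<open>distinct vs\<close> and \<open>set vs = verts G\<close>.
\<close>

definition adjacency_mat :: "('a, 'b, 'e) pre_mixed_graph \<Rightarrow> 'a list \<Rightarrow> real mat" where
  "adjacency_mat G vs = mat (length vs) (length vs) (\<lambda>(i, j).
     if i = j then 2 * real (card (edges_joining G (vs ! i) (vs ! i)))
     else real (card (edges_joining G (vs ! i) (vs ! j))))"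

definition arc_mat :: "('a, 'b, 'e) pre_mixed_graph \<Rightarrow> 'a list \<Rightarrow> real mat" where
  "arc_mat G vs = mat (length vs) (length vs) (\<lambda>(i, j).
     real (card (arcs_from_to G (vs ! i) (vs ! j))))"

definition integrated_adjacency_mat ::
    "('a, 'b, 'e) pre_mixed_graph \<Rightarrow> 'a list \<Rightarrow> real mat" where
  "integrated_adjacency_mat G vs =
     four_block_mat (adjacency_mat G vs) (arc_mat G vs)
       (transpose_mat (arc_mat G vs)) (adjacency_mat G vs)"

end

theory Submission
  imports Defs
begin

text \<open>
  In absolute value, an eigenvalue of a real square matrix is at most the largest absolute row
  sum, as one sees by comparing an eigenvector at a coordinate of largest absolute value with its
  image (\<open>eigenvalue_abs_le_row_sum\<close>). The integrated adjacency matrix has nonnegative entries,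
  and its row sums are degrees. The row of \<open>A\<close> that belongs to \<open>u\<close> sums to
  \<open>d(u)\<close>, because every edge at \<open>u\<close> has exactly one other end (\<open>u\<close> itself for a loop),
  and the doubled diagonal entry counts loops twice, as the degree does; the row and the
  column of \<open>D\<close> that belong to \<open>u\<close> sum to the numbers of arcs starting and
  ending at \<open>u\<close>. Hence the upper \<open>n\<close> rows have the sums
  \<open>d(u) + d\<^sup>+(u)\<close> and the lower \<open>n\<close> rows the sums \<open>d(u) + d\<^sup>-(u)\<close>, all of
  which are bounded by the larger of the two maxima.
\<close>

text \<open>
  At a coordinate \<open>i\<close> where an eigenvector \<open>x\<close> is largest in absolute value, every
  \<open>\<bar>x $ j\<bar>\<close> in row \<open>i\<close> of \<open>A x = k x\<close> may be replaced by
  \<open>\<bar>x $ i\<bar>\<close>, which then cancels because it is positive.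
\<close>

lemma eigenvalue_abs_le_row_sum:
  fixes A :: "real mat"
  assumes A: "A \<in> carrier_mat n n"
    and ev: "eigenvalue A k"
    and row: "\<And>i. i < n \<Longrightarrow> (\<Sum>j<n. \<bar>A $$ (i, j)\<bar>) \<le> c"
  shows "\<bar>k\<bar> \<le> c"
proof -
  from ev A obtain x where x: "x \<in> carrier_vec n" "x \<noteq> 0\<^sub>v n" "A *\<^sub>v x = k \<cdot>\<^sub>v x"
    unfolding eigenvalue_def eigenvector_def by auto
  from x(1,2) obtain l where l: "l < n" "x $ l \<noteq> 0"
    by (auto simp: vec_eq_iff)
  let ?M = "Max ((\<lambda>i. \<bar>x $ i\<bar>) ` {..<n})"
  have "?M \<in> (\<lambda>i. \<bar>x $ i\<bar>) ` {..<n}"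
    using l(1) by (intro Max_in) auto
  then obtain i where i: "i < n" "\<bar>x $ i\<bar> = ?M" by auto
  have max: "\<bar>x $ j\<bar> \<le> \<bar>x $ i\<bar>" if "j < n" for j
    unfolding i(2) using that by (intro Max_ge) auto
  have pos: "0 < \<bar>x $ i\<bar>" using max[OF l(1)] l(2) by linarith
  have "k * x $ i = (A *\<^sub>v x) $ i" using x(1,3) i(1) by simp
  also have "\<dots> = (\<Sum>j<n. A $$ (i, j) * x $ j)"
    using A x(1) i(1) by (simp add: scalar_prod_def lessThan_atLeast0)
  finally have "\<bar>k\<bar> * \<bar>x $ i\<bar> = \<bar>\<Sum>j<n. A $$ (i, j) * x $ j\<bar>"
    by (metis abs_mult)
  also have "\<dots> \<le> (\<Sum>j<n. \<bar>A $$ (i, j)\<bar> * \<bar>x $ j\<bar>)"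
    by (rule order_trans[OF sum_abs]) (simp add: abs_mult)
  also have "\<dots> \<le> (\<Sum>j<n. \<bar>A $$ (i, j)\<bar> * \<bar>x $ i\<bar>)"
    using max by (intro sum_mono mult_left_mono) auto
  also have "\<dots> = (\<Sum>j<n. \<bar>A $$ (i, j)\<bar>) * \<bar>x $ i\<bar>"
    by (simp add: sum_distrib_right)
  also have "\<dots> \<le> c * \<bar>x $ i\<bar>"
    using row[OF i(1)] by (intro mult_right_mono) auto
  finally show ?thesis using pos by simp
qed

lemma sum_nth_distinct:
  assumes "distinct xs"
  shows "(\<Sum>i<length xs. f (xs ! i)) = sum f (set xs)"
  using sum.reindex_bij_betw[OF bij_betw_nth[OF assms refl refl], of f] .

lemma sum_four_block_mat_row:
  fixes f :: "'a :: zero \<Rightarrow> 'b :: comm_monoid_add"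
  assumes A: "A \<in> carrier_mat n n" and B: "B \<in> carrier_mat n n"
    and C: "C \<in> carrier_mat n n" and D: "D \<in> carrier_mat n n" and i: "i < n"
  shows "(\<Sum>j<n + n. f (four_block_mat A B C D $$ (i, j)))
      = (\<Sum>j<n. f (A $$ (i, j))) + (\<Sum>j<n. f (B $$ (i, j)))"
    and "(\<Sum>j<n + n. f (four_block_mat A B C D $$ (n + i, j)))
      = (\<Sum>j<n. f (C $$ (i, j))) + (\<Sum>j<n. f (D $$ (i, j)))"
proof -
  have split: "(\<Sum>j<n + m. g j) = (\<Sum>j<n. g j) + (\<Sum>j<m. g (n + j))"
    for g :: "nat \<Rightarrow> 'b" and m
    by (induction m) (simp_all add: add.assoc)
  show "(\<Sum>j<n + n. f (four_block_mat A B C D $$ (i, j)))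
      = (\<Sum>j<n. f (A $$ (i, j))) + (\<Sum>j<n. f (B $$ (i, j)))"
    using A B C D i by (simp add: split)
  show "(\<Sum>j<n + n. f (four_block_mat A B C D $$ (n + i, j)))
      = (\<Sum>j<n. f (C $$ (i, j))) + (\<Sum>j<n. f (D $$ (i, j)))"
    using A B C D i by (simp add: split)
qed

context mixed_graph
begin

lemma finite_verts_arcs: "finite (verts G)" "finite (arcs G)"
  using finite_verts finite_arcs by (simp_all add: directed_part_def)

lemma ends_of_arc:
  assumes "a \<in> arcs G"
  shows "tail G a \<in> verts G" "head G a \<in> verts G"
  using assms tail_in_verts[of a] head_in_verts[of a] by (simp_all add: directed_part_def)

text \<open>
  The edges at \<open>u\<close> are classified by their other end; this class is unique because
  \<open>Upair u v = Upair u w\<close> forces \<open>v = w\<close>, also when \<open>v = u\<close>.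
\<close>

lemma deg_eq_sum_edges_joining:
  assumes u: "u \<in> verts G"
  shows "deg G u = (\<Sum>v\<in>verts G. card (edges_joining G u v)) + card (edges_joining G u u)"
proof -
  have "{e \<in> edges G. u \<in> set_uprod (ends G e)} = (\<Union>v\<in>verts G. edges_joining G u v)"
  proof (intro equalityI subsetI)
    fix e assume "e \<in> {e \<in> edges G. u \<in> set_uprod (ends G e)}"
    then have e: "e \<in> edges G" "u \<in> set_uprod (ends G e)" by auto
    obtain a b where ab: "ends G e = Upair a b" by (cases "ends G e") auto
    have "{a, b} \<subseteq> verts G" using ends_in_verts[OF e(1)] ab by simp
    then show "e \<in> (\<Union>v\<in>verts G. edges_joining G u v)"
      using e ab by (auto simp: edges_joining_def)
  qed (auto simp: edges_joining_def)
  moreover have "card (\<Union>v\<in>verts G. edges_joining G u v)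
      = (\<Sum>v\<in>verts G. card (edges_joining G u v))"
    using finite_verts_arcs finite_edges
    by (intro card_UN_disjoint) (auto simp: edges_joining_def)
  ultimately show ?thesis by (simp add: deg_def)
qed

lemma out_deg_eq_sum_arcs_from_to:
  "out_deg G u = (\<Sum>v\<in>verts G. card (arcs_from_to G u v))"
proof -
  have "out_arcs (directed_part G) u = (\<Union>v\<in>verts G. arcs_from_to G u v)"
    by (auto simp: out_arcs_def directed_part_def arcs_from_to_def ends_of_arc)
  moreover have "card (\<Union>v\<in>verts G. arcs_from_to G u v)
      = (\<Sum>v\<in>verts G. card (arcs_from_to G u v))"
    using finite_verts_arcs by (intro card_UN_disjoint) (auto simp: arcs_from_to_def)
  ultimately show ?thesis by (simp add: out_deg_def out_degree_def)
qed

lemma in_deg_eq_sum_arcs_from_to: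
  "in_deg G u = (\<Sum>v\<in>verts G. card (arcs_from_to G v u))"
proof -
  have "in_arcs (directed_part G) u = (\<Union>v\<in>verts G. arcs_from_to G v u)"
    by (auto simp: in_arcs_def directed_part_def arcs_from_to_def ends_of_arc)
  moreover have "card (\<Union>v\<in>verts G. arcs_from_to G v u)
      = (\<Sum>v\<in>verts G. card (arcs_from_to G v u))"
    using finite_verts_arcs by (intro card_UN_disjoint) (auto simp: arcs_from_to_def)
  ultimately show ?thesis by (simp add: in_deg_def in_degree_def)
qed

lemma sum_row_adjacency_mat:
  assumes vs: "distinct vs" "set vs = verts G" and i: "i < length vs"
  shows "(\<Sum>j<length vs. \<bar>adjacency_mat G vs $$ (i, j)\<bar>) = real (deg G (vs ! i))"
proof -
  let ?e = "\<lambda>v. real (card (edges_joining G (vs ! i) v))"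
  \<comment> \<open>One copy of the doubled diagonal entry is split off; it becomes the loop summand of the degree.\<close>
  have "(\<Sum>j<length vs. \<bar>adjacency_mat G vs $$ (i, j)\<bar>)
      = (\<Sum>j<length vs. ?e (vs ! j) + (if i = j then ?e (vs ! i) else 0))"
    using i by (intro sum.cong) (auto simp: adjacency_mat_def)
  also have "\<dots> = (\<Sum>v\<in>verts G. ?e v) + ?e (vs ! i)"
    using i sum_nth_distinct[OF vs(1), of ?e] vs(2) by (simp add: sum.distrib)
  also have "\<dots> = real (deg G (vs ! i))"
    using deg_eq_sum_edges_joining[of "vs ! i"] i vs(2) nth_mem[OF i] by simp
  finally show ?thesis .
qed

lemma sum_row_arc_mat:
  assumes vs: "distinct vs" "set vs = verts G" and i: "i < length vs"
  shows "(\<Sum>j<length vs. \<bar>arc_mat G vs $$ (i, j)\<bar>) = real (out_deg G (vs ! i))"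
  using i vs(2) sum_nth_distinct[OF vs(1), of "\<lambda>v. real (card (arcs_from_to G (vs ! i) v))"]
  by (simp add: arc_mat_def out_deg_eq_sum_arcs_from_to)

lemma sum_column_arc_mat:
  assumes vs: "distinct vs" "set vs = verts G" and i: "i < length vs"
  shows "(\<Sum>j<length vs. \<bar>arc_mat G vs $$ (j, i)\<bar>) = real (in_deg G (vs ! i))"
  using i vs(2) sum_nth_distinct[OF vs(1), of "\<lambda>v. real (card (arcs_from_to G v (vs ! i)))"]
  by (simp add: arc_mat_def in_deg_eq_sum_arcs_from_to)

lemma deg_add_out_deg_le_Delta1:
  assumes "u \<in> verts G"
  shows "deg G u + out_deg G u \<le> Delta1 G"
  unfolding Delta1_def using assms finite_verts_arcs(1) by (intro Max_ge) auto

lemma deg_add_in_deg_le_Delta2: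
  assumes "u \<in> verts G"
  shows "deg G u + in_deg G u \<le> Delta2 G"
  unfolding Delta2_def using assms finite_verts_arcs(1) by (intro Max_ge) auto

theorem eigenvalue_integrated_adjacency_mat_le:
  assumes vs: "distinct vs" "set vs = verts G"
    and ev: "eigenvalue (integrated_adjacency_mat G vs) ev"
  shows "\<bar>ev\<bar> \<le> real (max (Delta1 G) (Delta2 G))"
proof -
  let ?n = "length vs" and ?I = "integrated_adjacency_mat G vs"
  have A: "adjacency_mat G vs \<in> carrier_mat ?n ?n"
    by (simp add: adjacency_mat_def)
  have D: "arc_mat G vs \<in> carrier_mat ?n ?n" by (simp add: arc_mat_def)
  have DT: "transpose_mat (arc_mat G vs) \<in> carrier_mat ?n ?n" using D by simp
  note row = sum_four_block_mat_row[OF A D DT A, folded integrated_adjacency_mat_def]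
  have I: "?I \<in> carrier_mat (?n + ?n) (?n + ?n)"
    using A by (simp add: integrated_adjacency_mat_def)
  show ?thesis
  proof (rule eigenvalue_abs_le_row_sum[OF I ev])
    fix i assume i: "i < ?n + ?n"
    show "(\<Sum>j<?n + ?n. \<bar>?I $$ (i, j)\<bar>) \<le> real (max (Delta1 G) (Delta2 G))"
    proof (cases "i < ?n")
      case True
      have "(\<Sum>j<?n + ?n. \<bar>?I $$ (i, j)\<bar>) = real (deg G (vs ! i) + out_deg G (vs ! i))"
        using row(1)[OF True, of abs] sum_row_adjacency_mat[OF vs True]
          sum_row_arc_mat[OF vs True] by simp
      also have "\<dots> \<le> real (Delta1 G)"
        using deg_add_out_deg_le_Delta1[of "vs ! i"] nth_mem[OF True] vs(2)
        by (intro of_nat_mono) simp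
      finally show ?thesis by simp
    next
      case False
      define l where "l = i - ?n"
      have l: "l < ?n" "i = ?n + l" using False i by (auto simp: l_def)
      have "(\<Sum>j<?n. \<bar>transpose_mat (arc_mat G vs) $$ (l, j)\<bar>) = real (in_deg G (vs ! l))"
        using sum_column_arc_mat[OF vs l(1)] D l(1) by simp
      then have "(\<Sum>j<?n + ?n. \<bar>?I $$ (i, j)\<bar>) = real (deg G (vs ! l) + in_deg G (vs ! l))"
        using row(2)[OF l(1), of abs] sum_row_adjacency_mat[OF vs l(1)] l(2) by simp
      also have "\<dots> \<le> real (Delta2 G)"
        using deg_add_in_deg_le_Delta2[of "vs ! l"] nth_mem[OF l(1)] vs(2)
        by (intro of_nat_mono) simp
      finally show ?thesis by simp
    qed
  qed
qed

end

theorem theorem8p1: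
  fixes G :: "('a, 'b, 'e) pre_mixed_graph" and vs :: "'a list" and ev :: real
  assumes "simple_mixed_graph G"
    and "distinct vs" and "set vs = verts G"
    and "eigenvalue (integrated_adjacency_mat G vs) ev"
  shows "\<bar>ev\<bar> \<le> real (max (Delta1 G) (Delta2 G))"
proof -
  interpret simple_mixed_graph G by fact
  show ?thesis using assms(2-4) by (rule eigenvalue_integrated_adjacency_mat_le)
qed

end
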